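(* Let $T\in\mathbb{N}$, let $\mathcal{X},\mathcal{U},\mathcal{Y}$ be Polish spaces, let $f:\mathcal{X}\times\mathcal{U}\to\mathcal{X}$ and $h:\mathcal{X}\times\mathcal{U}\to\mathcal{Y}$ be continuous, and let $\rho_0\in\mathcal{P}(\mathcal{X})$. Then the behavioral-measure set $\mathcal{M}_{\mathcal{B}}$ and its initial slice $\mathcal{M}_{\mathcal{B}}(\rho_0)$ are convex and closed under weak convergence in $\mathcal{P}(\Omega_T)$.
   Context: For a Polish space $S$, $\mathcal{P}(S)$ denotes the set of Borel probability measures on $S$; weak convergence is convergence against bounded continuous real-valued functions. For a measurable map $\varphi$ and a measure $\mu$, the pushforward is $\varphi_{\#}\mu(A)=\mu(\varphi^{-1}(A))$. The trajectory space is $\Omega_T:=\mathcal{X}^{T+1}\times\mathcal{U}^T\times\mathcal{Y}^T$ with its product topology and Borel $\sigma$-algebra. For $\omega=(x_{0:T},u_{0:T-1},y_{0:T-1})\in\Omega_T$ the coordinate maps are $X_t(\omega)=x_t$, $U_t(\omega)=u_t$, $Y_t(\omega)=y_t$. The admissible path set is $$\mathfrak{B}_T:=\{\omega\in\Omega_T: X_{t+1}(\omega)=f(X_t(\omega),U_t(\omega)),\ Y_t(\omega)=h(X_t(\omega),U_t(\omega)),\ t=0,\dots,T-1\}.$$ The behavioral-measure set is $\mathcal{M}_{\mathcal{B}}:=\{\mu\in\mathcal{P}(\Omega_T):\mu(\mathfrak{B}_T)=1\}$, and its initial slice at $\rho_0\in\mathcal{P}(\mathcal{X})$ is $\mathcal{M}_{\mathcal{B}}(\rho_0):=\{\mu\in\mathcal{M}_{\mathcal{B}}:(X_0)_{\#}\mu=\rho_0\}$.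 *)

theory Defs
  imports "HOL-Probability.Probability"
begin

text \<open>Spaces are abstract topologies rather than instances of the class of Polish types: the path
  space depends on the natural number \<open>T\<close> and lives on a proper subset of a function type.\<close>

definition Polish_space :: "'a topology \<Rightarrow> bool" where
  "Polish_space X \<longleftrightarrow> completely_metrizable_space X \<and> separable_space X"

definition borel_on :: "'a topology \<Rightarrow> 'a measure" where
  "borel_on X = sigma (topspace X) {S. openin X S}"

definition prob_measures :: "'a topology \<Rightarrow> 'a measure set" where
  "prob_measures X = {\<mu>. prob_space \<mu> \<and> sets \<mu> = sets (borel_on X)}"

definition bounded_continuous :: "'a topology \<Rightarrow> ('a \<Rightarrow> real) set" where
  "bounded_continuous X = {g. continuous_map X euclideanreal g \<and> bounded (g ` topspace X)}"

text \<open>The coarsest topology on the probability measures for which integration against each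
  bounded continuous function is continuous; its limits are characterised in
  \<open>limitin_weak_topology\<close> below.\<close>

definition weak_topology :: "'a topology \<Rightarrow> 'a measure topology" where
  "weak_topology X = topology_generated_by
     {{\<mu> \<in> prob_measures X. (\<integral>x. g x \<partial>\<mu>) \<in> V} | g V. g \<in> bounded_continuous X \<and> open V}"

text \<open>The type of measures is not a vector space, so convex combinations are defined
  setwise; see \<open>emeasure_mix_measure\<close>.\<close>

definition mix_measure :: "real \<Rightarrow> 'a measure \<Rightarrow> 'a measure \<Rightarrow> 'a measure" where
  "mix_measure a \<mu> \<nu> = measure_of (space \<mu>) (sets \<mu>)
     (\<lambda>A. ennreal a * emeasure \<mu> A + ennreal (1 - a) * emeasure \<nu> A)"

definition convex_measures :: "'a measure set \<Rightarrow> bool" where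
  "convex_measures M \<longleftrightarrow> (\<forall>\<mu>\<in>M. \<forall>\<nu>\<in>M. \<forall>a\<in>{0..1}. mix_measure a \<mu> \<nu> \<in> M)"

text \<open>A trajectory is a triple \<open>(x, u, y)\<close> of functions on \<open>nat\<close>, where \<open>x\<close> is
  extensional on \<open>{..T}\<close> and \<open>u\<close>, \<open>y\<close> are extensional on \<open>{..<T}\<close>.\<close>

type_synonym ('x, 'u, 'y) trajectory = "(nat \<Rightarrow> 'x) \<times> (nat \<Rightarrow> 'u) \<times> (nat \<Rightarrow> 'y)"

definition traj_space ::
    "nat \<Rightarrow> 'x topology \<Rightarrow> 'u topology \<Rightarrow> 'y topology \<Rightarrow> ('x, 'u, 'y) trajectory topology" where
  "traj_space T X U Y =
     prod_topology (product_topology (\<lambda>_. X) {..T})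
       (prod_topology (product_topology (\<lambda>_. U) {..<T}) (product_topology (\<lambda>_. Y) {..<T}))"

definition coord_X :: "nat \<Rightarrow> ('x, 'u, 'y) trajectory \<Rightarrow> 'x" where
  "coord_X t \<omega> = fst \<omega> t"

definition coord_U :: "nat \<Rightarrow> ('x, 'u, 'y) trajectory \<Rightarrow> 'u" where
  "coord_U t \<omega> = fst (snd \<omega>) t"

definition coord_Y :: "nat \<Rightarrow> ('x, 'u, 'y) trajectory \<Rightarrow> 'y" where
  "coord_Y t \<omega> = snd (snd \<omega>) t"

definition admissible_paths ::
    "nat \<Rightarrow> 'x topology \<Rightarrow> 'u topology \<Rightarrow> 'y topology \<Rightarrow> ('x \<times> 'u \<Rightarrow> 'x) \<Rightarrow> ('x \<times> 'u \<Rightarrow> 'y)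
      \<Rightarrow> ('x, 'u, 'y) trajectory set" where
  "admissible_paths T X U Y f h = {\<omega> \<in> topspace (traj_space T X U Y). \<forall>t<T.
     coord_X (t + 1) \<omega> = f (coord_X t \<omega>, coord_U t \<omega>) \<and>
     coord_Y t \<omega> = h (coord_X t \<omega>, coord_U t \<omega>)}"

definition behavioral_measures ::
    "nat \<Rightarrow> 'x topology \<Rightarrow> 'u topology \<Rightarrow> 'y topology \<Rightarrow> ('x \<times> 'u \<Rightarrow> 'x) \<Rightarrow> ('x \<times> 'u \<Rightarrow> 'y)
      \<Rightarrow> ('x, 'u, 'y) trajectory measure set" where
  "behavioral_measures T X U Y f h =
     {\<mu> \<in> prob_measures (traj_space T X U Y). emeasure \<mu> (admissible_paths T X U Y f h) = 1}"

definition initial_slice ::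
    "nat \<Rightarrow> 'x topology \<Rightarrow> 'u topology \<Rightarrow> 'y topology \<Rightarrow> ('x \<times> 'u \<Rightarrow> 'x) \<Rightarrow> ('x \<times> 'u \<Rightarrow> 'y)
      \<Rightarrow> 'x measure \<Rightarrow> ('x, 'u, 'y) trajectory measure set" where
  "initial_slice T X U Y f h \<rho>\<^sub>0 =
     {\<mu> \<in> behavioral_measures T X U Y f h. distr \<mu> (borel_on X) (coord_X 0) = \<rho>\<^sub>0}"


lemma space_borel_on [simp]: "space (borel_on X) = topspace X"
  unfolding borel_on_def by (rule space_measure_of) (auto dest: openin_subset)

lemma sets_borel_on: "sets (borel_on X) = sigma_sets (topspace X) {S. openin X S}"
  unfolding borel_on_def by (rule sets_measure_of) (auto dest: openin_subset)

lemma measurable_borel_on: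
  assumes "continuous_map X Y g"
  shows "g \<in> borel_on X \<rightarrow>\<^sub>M borel_on Y"
proof (rule measurable_sigma_sets[OF sets_borel_on])
  show "g \<in> space (borel_on X) \<rightarrow> topspace Y"
    using assms by (auto dest: continuous_map_funspace)
  fix S assume "S \<in> {S. openin Y S}"
  then have "openin X {x \<in> topspace X. g x \<in> S}"
    using assms by (auto simp: openin_continuous_map_preimage)
  moreover have "g -` S \<inter> space (borel_on X) = {x \<in> topspace X. g x \<in> S}"
    by auto
  ultimately show "g -` S \<inter> space (borel_on X) \<in> sets (borel_on X)"
    by (auto simp: sets_borel_on)
qed (auto dest: openin_subset)

lemma borel_on_euclidean: "borel_on euclidean = borel"
  by (simp add: borel_on_def borel_def)

lemma coord_X_0_measurable: "coord_X 0 \<in> borel_on (traj_space T X U Y) \<rightarrow>\<^sub>M borel_on X"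
proof (rule measurable_borel_on)
  have "continuous_map (traj_space T X U Y) X ((\<lambda>x. x 0) \<circ> fst)"
    unfolding traj_space_def
    by (rule continuous_map_compose[OF continuous_map_fst])
       (rule continuous_map_product_projection, simp)
  then show "continuous_map (traj_space T X U Y) X (coord_X 0)"
    by (simp add: coord_X_def[abs_def] comp_def)
qed

lemma integrable_bounded_continuous:
  assumes "\<mu> \<in> prob_measures X" "g \<in> bounded_continuous X"
  shows "integrable \<mu> g"
proof -
  interpret prob_space \<mu> using assms by (simp add: prob_measures_def)
  have sets: "sets \<mu> = sets (borel_on X)" using assms by (simp add: prob_measures_def)
  then have space: "space \<mu> = topspace X" using sets_eq_imp_space_eq[OF sets] by simp
  obtain B where "\<And>x. x \<in> topspace X \<Longrightarrow> norm (g x) \<le> B"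
    using assms(2) by (auto simp: bounded_continuous_def bounded_iff)
  moreover have "g \<in> borel_measurable \<mu>"
    using measurable_borel_on[of X euclideanreal g] assms(2)
    by (simp add: bounded_continuous_def borel_on_euclidean measurable_cong_sets[OF sets refl])
  ultimately show ?thesis
    by (intro integrable_const_bound[where B = B]) (auto simp: space)
qed

lemma topspace_weak_topology [simp]: "topspace (weak_topology X) = prob_measures X"
proof -
  have "(\<lambda>_. 0) \<in> bounded_continuous X"
    by (auto simp: bounded_continuous_def bounded_iff)
  then have "{\<mu> \<in> prob_measures X. (\<integral>x. (\<lambda>_. 0 :: real) x \<partial>\<mu>) \<in> UNIV} \<in>
      {{\<mu> \<in> prob_measures X. (\<integral>x. g x \<partial>\<mu>) \<in> V} | g V. g \<in> bounded_continuous X \<and> open V}"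
    by blast
  then show ?thesis
    unfolding weak_topology_def topology_generated_by_topspace by auto
qed

lemma limitin_weak_topology:
  "limitin (weak_topology X) \<mu> \<nu> F \<longleftrightarrow>
     \<nu> \<in> prob_measures X \<and> (\<forall>\<^sub>F i in F. \<mu> i \<in> prob_measures X) \<and>
     (\<forall>g\<in>bounded_continuous X. ((\<lambda>i. \<integral>x. g x \<partial>\<mu> i) \<longlongrightarrow> (\<integral>x. g x \<partial>\<nu>)) F)"
  (is "?L \<longleftrightarrow> ?R")
proof
  assume L: ?L
  then have \<nu>: "\<nu> \<in> prob_measures X"
    by (simp add: limitin_def)
  have "\<forall>\<^sub>F i in F. \<mu> i \<in> prob_measures X"
    using L \<nu> openin_topspace[of "weak_topology X"] unfolding limitin_def by simp
  moreover have "((\<lambda>i. \<integral>x. g x \<partial>\<mu> i) \<longlongrightarrow> (\<integral>x. g x \<partial>\<nu>)) F" if g: "g \<in> bounded_continuous X" for g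
  proof (rule topological_tendstoI)
    fix V :: "real set" assume V: "open V" "(\<integral>x. g x \<partial>\<nu>) \<in> V"
    have "openin (weak_topology X) {\<mu> \<in> prob_measures X. (\<integral>x. g x \<partial>\<mu>) \<in> V}"
      unfolding weak_topology_def by (rule topology_generated_by_Basis) (use g V in blast)
    then have "\<forall>\<^sub>F i in F. \<mu> i \<in> {\<mu> \<in> prob_measures X. (\<integral>x. g x \<partial>\<mu>) \<in> V}"
      using L V \<nu> unfolding limitin_def by blast
    then show "\<forall>\<^sub>F i in F. (\<integral>x. g x \<partial>\<mu> i) \<in> V"
      by (rule eventually_mono) simp
  qed
  ultimately show ?R using \<nu> by blast
next
  assume R: ?R
  have "\<nu> \<in> W \<longrightarrow> (\<forall>\<^sub>F i in F. \<mu> i \<in> W)" if "openin (weak_topology X) W" for W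
    using openin_topology_generated_by[OF that[unfolded weak_topology_def]]
  proof induction
    case (Basis S)
    then obtain g V where gV: "g \<in> bounded_continuous X" "open V"
      and S: "S = {\<mu> \<in> prob_measures X. (\<integral>x. g x \<partial>\<mu>) \<in> V}" by blast
    show ?case
    proof
      assume "\<nu> \<in> S"
      then have "\<forall>\<^sub>F i in F. (\<integral>x. g x \<partial>\<mu> i) \<in> V"
        using R gV topological_tendstoD unfolding S by blast
      with R show "\<forall>\<^sub>F i in F. \<mu> i \<in> S"
        unfolding S by (auto elim: eventually_elim2)
    qed
  next
    case (UN K)
    show ?case
    proof
      assume "\<nu> \<in> \<Union> K"
      then obtain k where "k \<in> K" "\<nu> \<in> k" by blast
      with UN have "\<forall>\<^sub>F i in F. \<mu> i \<in> k" by blast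
      then show "\<forall>\<^sub>F i in F. \<mu> i \<in> \<Union> K"
        by (rule eventually_mono) (use \<open>k \<in> K\<close> in blast)
    qed
  qed (auto simp: eventually_conj_iff)
  with R show ?L by (simp add: limitin_def)
qed

lemma closedin_weak_topology_sequentially:
  assumes "closedin (weak_topology X) M" "\<And>n. \<mu> n \<in> M" "\<nu> \<in> prob_measures X"
    and "\<And>g. g \<in> bounded_continuous X \<Longrightarrow> (\<lambda>n. \<integral>x. g x \<partial>\<mu> n) \<longlonglongrightarrow> (\<integral>x. g x \<partial>\<nu>)"
  shows "\<nu> \<in> M"
proof (rule limitin_closedin)
  have "\<mu> n \<in> prob_measures X" for n
    using closedin_subset[OF assms(1)] assms(2) by auto
  then show "limitin (weak_topology X) \<mu> \<nu> sequentially"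
    using assms(3,4) by (simp add: limitin_weak_topology)
qed (use assms in auto)

lemma space_mix_measure [simp]: "space (mix_measure a \<mu> \<nu>) = space \<mu>"
  unfolding mix_measure_def by (simp add: sets.space_closed)

lemma sets_mix_measure [simp]: "sets (mix_measure a \<mu> \<nu>) = sets \<mu>"
  unfolding mix_measure_def by (simp add: sets.space_closed sets.sigma_sets_eq)

lemma emeasure_mix_measure:
  assumes "sets \<mu> = sets \<nu>" "A \<in> sets \<mu>"
  shows "emeasure (mix_measure a \<mu> \<nu>) A = ennreal a * emeasure \<mu> A + ennreal (1 - a) * emeasure \<nu> A"
proof (rule emeasure_measure_of[OF mix_measure_def])
  show "countably_additive (sets (mix_measure a \<mu> \<nu>))
      (\<lambda>A. ennreal a * emeasure \<mu> A + ennreal (1 - a) * emeasure \<nu> A)"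
  proof (rule countably_additiveI)
    fix B :: "nat \<Rightarrow> 'a set"
    assume "range B \<subseteq> sets (mix_measure a \<mu> \<nu>)" "disjoint_family B"
    then show "(\<Sum>i. ennreal a * emeasure \<mu> (B i) + ennreal (1 - a) * emeasure \<nu> (B i)) =
        ennreal a * emeasure \<mu> (\<Union>i. B i) + ennreal (1 - a) * emeasure \<nu> (\<Union>i. B i)"
      using assms(1) by (simp add: suminf_add[symmetric] suminf_emeasure)
  qed
qed (use assms in \<open>auto simp: positive_def sets.space_closed dest: sets.sets_into_space\<close>)

end

theory Submission
  imports Defs
begin

text \<open>A behavioral measure is a probability measure that gives full mass to the set of admissible
  paths, so the theorem splits into a statement about a fixed full-measure set and a
  statement about a fixed marginal. Both constraints are affine in the measure, and a mixture
  of measures with the same marginal \<open>\<rho>\<^sub>0\<close> has marginal \<open>\<rho>\<^sub>0\<close>; this gives convexity.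

  For closedness, the admissible paths form a closed set, because they are cut out by finitely many
  equations between continuous maps into Hausdorff spaces. The trajectory space is
  metrizable, so the indicator of a closed set \<open>C\<close> is a pointwise limit of bounded continuous
  functions \<open>g\<^sub>n\<close> with values between it and \<open>1\<close> (\<open>closed_indicator_approximation\<close>). By
  dominated convergence, a probability measure has mass \<open>1\<close> on \<open>C\<close> exactly if it integrates every
  \<open>g\<^sub>n\<close> to \<open>1\<close>. Each of these conditions is weakly closed, since integration against a bounded
  continuous function is weakly continuous (\<open>closedin_full_mass_on_closed\<close>).

  The same approximation shows that a probability measure on a metrizable space is determined
  by its integrals of bounded continuous functions, so that \<open>{\<rho>\<^sub>0}\<close> is weakly closed
  (\<open>closedin_singleton_weak_topology\<close>). The marginal at time \<open>0\<close> depends weakly continuously on the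
  measure (\<open>continuous_map_pushforward\<close>), and the initial slice is the preimage of \<open>{\<rho>\<^sub>0}\<close>
  within the closed set of behavioral measures.\<close>

section \<open>Mixtures of probability measures\<close>

lemma prob_measuresD:
  assumes "\<mu> \<in> prob_measures X"
  shows "prob_space \<mu>" "sets \<mu> = sets (borel_on X)" "space \<mu> = topspace X"
proof -
  show "prob_space \<mu>" and sets: "sets \<mu> = sets (borel_on X)"
    using assms by (auto simp: prob_measures_def)
  show "space \<mu> = topspace X"
    using sets_eq_imp_space_eq[OF sets] by simp
qed

lemma convex_combination_same:
  fixes c :: ennreal
  assumes "a \<in> {0..1}"
  shows "ennreal a * c + ennreal (1 - a) * c = c"
proof -
  have "ennreal a + ennreal (1 - a) = 1"
    using assms by (simp flip: ennreal_plus)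
  then show ?thesis
    by (simp flip: distrib_right)
qed

lemma mix_measure_in_prob_measures:
  assumes "\<mu> \<in> prob_measures X" "\<nu> \<in> prob_measures X" "a \<in> {0..1}"
  shows "mix_measure a \<mu> \<nu> \<in> prob_measures X"
proof -
  note \<mu> = prob_measuresD[OF assms(1)] and \<nu> = prob_measuresD[OF assms(2)]
  have "emeasure (mix_measure a \<mu> \<nu>) (space \<mu>) = ennreal a * 1 + ennreal (1 - a) * 1"
    using \<mu> \<nu> prob_space.emeasure_space_1[OF \<mu>(1)] prob_space.emeasure_space_1[OF \<nu>(1)]
      sets.top[of \<mu>]
    by (subst emeasure_mix_measure) auto
  also have "\<dots> = 1"
    by (rule convex_combination_same[OF assms(3)])
  finally show ?thesis
    using \<mu>(2) by (auto simp: prob_measures_def intro!: prob_spaceI)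
qed

lemma mix_measure_same:
  assumes "a \<in> {0..1}"
  shows "mix_measure a \<rho> \<rho> = \<rho>"
  by (rule measure_eqI) (simp_all add: emeasure_mix_measure convex_combination_same[OF assms])

lemma distr_mix_measure:
  assumes "sets \<mu> = sets \<nu>" "p \<in> \<mu> \<rightarrow>\<^sub>M N"
  shows "distr (mix_measure a \<mu> \<nu>) N p = mix_measure a (distr \<mu> N p) (distr \<nu> N p)"
proof (rule measure_eqI)
  fix A assume "A \<in> sets (distr (mix_measure a \<mu> \<nu>) N p)"
  then have A: "A \<in> sets N" by simp
  have p: "p \<in> \<nu> \<rightarrow>\<^sub>M N" "p \<in> mix_measure a \<mu> \<nu> \<rightarrow>\<^sub>M N"
    using assms(2) measurable_cong_sets[OF assms(1) refl, of N]
      measurable_cong_sets[OF sets_mix_measure refl, of a \<mu> \<nu> N] by blast+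
  have "p -` A \<inter> space \<mu> \<in> sets \<mu>"
    using assms(2) A by (rule measurable_sets)
  then show "emeasure (distr (mix_measure a \<mu> \<nu>) N p) A =
      emeasure (mix_measure a (distr \<mu> N p) (distr \<nu> N p)) A"
    using A assms p sets_eq_imp_space_eq[OF assms(1)]
    by (simp add: emeasure_distr emeasure_mix_measure)
qed simp

lemma convex_measures_full_mass:
  "convex_measures {\<mu> \<in> prob_measures X. emeasure \<mu> C = 1}"
  unfolding convex_measures_def
proof (intro ballI)
  fix \<mu> \<nu> and a :: real
  assume \<mu>: "\<mu> \<in> {\<mu> \<in> prob_measures X. emeasure \<mu> C = 1}"
    and \<nu>: "\<nu> \<in> {\<mu> \<in> prob_measures X. emeasure \<mu> C = 1}" and a: "a \<in> {0..1}"
  \<comment> \<open>A set outside the \<sigma>-algebra has \<open>emeasure\<close> zero by convention.\<close>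
  have "C \<in> sets \<mu>"
    using \<mu> emeasure_notin_sets[of C \<mu>] by fastforce
  then have "emeasure (mix_measure a \<mu> \<nu>) C = 1"
    using \<mu> \<nu> prob_measuresD(2)[of \<mu> X] prob_measuresD(2)[of \<nu> X] convex_combination_same[OF a, of 1]
    by (subst emeasure_mix_measure) auto
  then show "mix_measure a \<mu> \<nu> \<in> {\<mu> \<in> prob_measures X. emeasure \<mu> C = 1}"
    using \<mu> \<nu> a mix_measure_in_prob_measures by auto
qed

lemma convex_measures_fixed_pushforward:
  assumes "convex_measures M" "M \<subseteq> prob_measures Z" "p \<in> borel_on Z \<rightarrow>\<^sub>M N"
  shows "convex_measures {\<mu> \<in> M. distr \<mu> N p = \<rho>}"
  unfolding convex_measures_def
proof (intro ballI)
  fix \<mu> \<nu> and a :: real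
  assume \<mu>: "\<mu> \<in> {\<mu> \<in> M. distr \<mu> N p = \<rho>}" and \<nu>: "\<nu> \<in> {\<mu> \<in> M. distr \<mu> N p = \<rho>}"
    and a: "a \<in> {0..1}"
  have sets: "sets \<mu> = sets (borel_on Z)" "sets \<nu> = sets (borel_on Z)"
    using \<mu> \<nu> assms(2) prob_measuresD(2) by blast+
  have "p \<in> \<mu> \<rightarrow>\<^sub>M N"
    using assms(3) measurable_cong_sets[OF sets(1) refl] by blast
  then have "distr (mix_measure a \<mu> \<nu>) N p = \<rho>"
    using sets \<mu> \<nu> by (simp add: distr_mix_measure mix_measure_same[OF a])
  then show "mix_measure a \<mu> \<nu> \<in> {\<mu> \<in> M. distr \<mu> N p = \<rho>}"
    using assms(1) \<mu> \<nu> a by (auto simp: convex_measures_def)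
qed

section \<open>Bounded continuous functions and closed sets\<close>

text \<open>In a metrizable space a closed set is the intersection of a decreasing sequence of
  open sets \<open>G\<^sub>n\<close>. Urysohn functions that are \<open>1\<close> on \<open>C\<close> and \<open>0\<close> off \<open>G\<^sub>n\<close> are
  zero for all large \<open>n\<close> at every point outside \<open>C\<close>.\<close>

lemma closed_indicator_approximation:
  assumes "metrizable_space Z" "closedin Z C"
  obtains g :: "nat \<Rightarrow> 'a \<Rightarrow> real" where
    "\<And>n. g n \<in> bounded_continuous Z"
    "\<And>n z. z \<in> topspace Z \<Longrightarrow> g n z \<in> {0..1}"
    "\<And>n z. z \<in> C \<Longrightarrow> g n z = 1"
    "\<And>z. z \<in> topspace Z \<Longrightarrow> (\<lambda>n. g n z) \<longlonglongrightarrow> indicator C z"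
proof -
  obtain G where G: "\<And>n :: nat. openin Z (G n)" "\<And>n. G (Suc n) \<subseteq> G n" "\<Inter>(range G) = C"
    using closed_imp_gdelta_in[OF assms] unfolding gdelta_in_descending by blast
  have "\<exists>g. continuous_map Z (top_of_set {0..1::real}) g \<and> g ` (topspace Z - G n) \<subseteq> {0} \<and> g ` C \<subseteq> {1}" for n
  proof (rule Urysohn_lemma[where a = 0 and b = "1 :: real"])
    show "normal_space Z" by (rule metrizable_imp_normal_space[OF assms(1)])
    show "closedin Z (topspace Z - G n)" using G(1) by blast
    show "disjnt (topspace Z - G n) C" using G(3) by (auto simp: disjnt_def)
  qed (use assms(2) in auto)
  then obtain g where g: "\<And>n. continuous_map Z (top_of_set {0..1::real}) (g n)"
      "\<And>n. g n ` (topspace Z - G n) \<subseteq> {0}" "\<And>n. g n ` C \<subseteq> {1}"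
    by metis
  have range: "g n z \<in> {0..1}" if "z \<in> topspace Z" for n z
    using g(1)[of n] that by (auto simp: continuous_map_in_subtopology)
  show thesis
  proof
    fix n
    have "bounded (g n ` topspace Z)"
      by (rule bounded_subset[of "{0..1}"]) (use range in auto)
    then show "g n \<in> bounded_continuous Z"
      using g(1)[of n] by (simp add: bounded_continuous_def continuous_map_in_subtopology)
  next
    fix z assume z: "z \<in> topspace Z"
    show "(\<lambda>n. g n z) \<longlonglongrightarrow> indicator C z"
    proof (cases "z \<in> C")
      case True
      then have "g n z = 1" for n using g(3)[of n] by auto
      then show ?thesis using True by simp
    next
      case False
      then obtain N where N: "z \<notin> G N" using G(3) by blast
      have "G n \<subseteq> G N" if "N \<le> n" for n
        using that G(2) by (rule lift_Suc_antimono_le[rotated])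
      then have "g n z = 0" if "N \<le> n" for n
        using that N z g(2)[of n] by blast
      then have "(\<lambda>n. g n z) \<longlonglongrightarrow> 0"
        by (intro tendsto_eventually) (auto simp: eventually_sequentially)
      then show ?thesis using False by simp
    qed
  qed (use range g(3) in blast)+
qed

lemma closedin_borel_on:
  assumes "closedin Z C"
  shows "C \<in> sets (borel_on Z)"
proof -
  have "topspace Z - C \<in> sets (borel_on Z)"
    using assms by (auto simp: sets_borel_on closedin_def)
  then have "topspace Z - (topspace Z - C) \<in> sets (borel_on Z)"
    using sets.compl_sets[of _ "borel_on Z"] by simp
  then show ?thesis
    using closedin_subset[OF assms] by (simp add: double_diff)
qed

lemma integral_tendsto_measure:
  fixes g :: "nat \<Rightarrow> 'a \<Rightarrow> real"
  assumes \<mu>: "\<mu> \<in> prob_measures Z" and C: "closedin Z C"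
    and g: "\<And>n. g n \<in> bounded_continuous Z"
    and range: "\<And>n z. z \<in> topspace Z \<Longrightarrow> g n z \<in> {0..1}"
    and lim: "\<And>z. z \<in> topspace Z \<Longrightarrow> (\<lambda>n. g n z) \<longlonglongrightarrow> indicator C z"
  shows "(\<lambda>n. \<integral>z. g n z \<partial>\<mu>) \<longlonglongrightarrow> measure \<mu> C"
proof -
  note \<mu>' = prob_measuresD[OF \<mu>]
  interpret prob_space \<mu> by (fact \<mu>')
  have C_sets: "C \<in> sets \<mu>"
    using closedin_borel_on[OF C] \<mu>' by simp
  have "(\<lambda>n. \<integral>z. g n z \<partial>\<mu>) \<longlonglongrightarrow> (\<integral>z. indicator C z \<partial>\<mu>)"
  proof (rule integral_dominated_convergence[where w = "\<lambda>_. 1"])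
    show "g n \<in> borel_measurable \<mu>" for n
      using integrable_bounded_continuous[OF \<mu> g] by auto
    show "AE z in \<mu>. (\<lambda>n. g n z) \<longlonglongrightarrow> indicator C z"
      using lim \<mu>' by auto
    show "AE z in \<mu>. norm (g n z) \<le> 1" for n
      using range[of _ n] \<mu>' by fastforce
  qed (use C_sets in auto)
  moreover have "C \<inter> space \<mu> = C"
    using closedin_subset[OF C] \<mu>' by auto
  ultimately show ?thesis by simp
qed

section \<open>Weakly closed constraints\<close>

lemma continuous_map_integral:
  assumes "g \<in> bounded_continuous X"
  shows "continuous_map (weak_topology X) euclideanreal (\<lambda>\<mu>. \<integral>x. g x \<partial>\<mu>)"
  unfolding continuous_map_def
proof (intro conjI allI impI)
  fix V :: "real set" assume "openin euclidean V"
  then have "openin (weak_topology X) {\<mu> \<in> prob_measures X. (\<integral>x. g x \<partial>\<mu>) \<in> V}"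
    unfolding weak_topology_def using assms by (intro topology_generated_by_Basis) auto
  then show "openin (weak_topology X) {\<mu> \<in> topspace (weak_topology X). (\<integral>x. g x \<partial>\<mu>) \<in> V}"
    by simp
qed simp

lemma closedin_integral_eq:
  assumes "g \<in> bounded_continuous X"
  shows "closedin (weak_topology X) {\<mu> \<in> prob_measures X. (\<integral>x. g x \<partial>\<mu>) = c}"
  using closedin_continuous_map_preimage[OF continuous_map_integral[OF assms], of "{c}"] by simp

text \<open>Weak limits can gain mass on a closed set but never lose it, so full mass is preserved.
  This takes the form that full mass on \<open>C\<close> is equivalent to countably many
  weakly closed conditions.\<close>

lemma closedin_full_mass_on_closed:
  assumes "metrizable_space Z" "closedin Z C"
  shows "closedin (weak_topology Z) {\<mu> \<in> prob_measures Z. emeasure \<mu> C = 1}"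
proof -
  obtain g :: "nat \<Rightarrow> 'a \<Rightarrow> real" where g: "\<And>n. g n \<in> bounded_continuous Z"
    and range: "\<And>n z. z \<in> topspace Z \<Longrightarrow> g n z \<in> {0..1}"
    and one: "\<And>n z. z \<in> C \<Longrightarrow> g n z = 1"
    and lim: "\<And>z. z \<in> topspace Z \<Longrightarrow> (\<lambda>n. g n z) \<longlonglongrightarrow> indicator C z"
    using closed_indicator_approximation[OF assms] by blast
  have "emeasure \<mu> C = 1 \<longleftrightarrow> (\<forall>n. (\<integral>z. g n z \<partial>\<mu>) = 1)" if \<mu>: "\<mu> \<in> prob_measures Z" for \<mu>
  proof
    note \<mu>' = prob_measuresD[OF \<mu>]
    interpret prob_space \<mu> by (fact \<mu>')
    have C_sets: "C \<in> sets \<mu>"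
      using closedin_borel_on[OF assms(2)] \<mu>' by simp
    show "\<forall>n. (\<integral>z. g n z \<partial>\<mu>) = 1" if mass: "emeasure \<mu> C = 1"
    proof
      fix n
      have "AE z in \<mu>. z \<in> C"
        using mass prob_eq_1[OF C_sets] by (simp add: emeasure_eq_measure)
      then have "AE z in \<mu>. g n z = 1"
        by (rule AE_mp) (use one in simp)
      then have "(\<integral>z. g n z \<partial>\<mu>) = (\<integral>z. 1 \<partial>\<mu>)"
        using integrable_bounded_continuous[OF \<mu> g] by (intro integral_cong_AE) auto
      then show "(\<integral>z. g n z \<partial>\<mu>) = 1"
        by (simp add: prob_space)
    qed
    show "emeasure \<mu> C = 1" if "\<forall>n. (\<integral>z. g n z \<partial>\<mu>) = 1"
    proof -
      have "(\<lambda>n. 1 :: real) \<longlonglongrightarrow> measure \<mu> C"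
        using integral_tendsto_measure[OF \<mu> assms(2) g range lim] that by simp
      then have "measure \<mu> C = 1"
        using LIMSEQ_unique[OF tendsto_const] by metis
      then show ?thesis by (simp add: emeasure_eq_measure)
    qed
  qed
  then have "{\<mu> \<in> prob_measures Z. emeasure \<mu> C = 1} =
      (\<Inter>n. {\<mu> \<in> prob_measures Z. (\<integral>z. g n z \<partial>\<mu>) = 1})"
    by auto
  then show ?thesis
    using closedin_integral_eq[OF g] by auto
qed

text \<open>By \<open>closed_indicator_approximation\<close>, the integrals determine the mass of closed sets,
  hence that of their open complements, which are a generator stable under intersection.\<close>

lemma prob_measures_eqI_integral:
  assumes Z: "metrizable_space Z" and \<mu>: "\<mu> \<in> prob_measures Z" and \<nu>: "\<nu> \<in> prob_measures Z"
    and eq: "\<And>g. g \<in> bounded_continuous Z \<Longrightarrow> (\<integral>z. g z \<partial>\<mu>) = (\<integral>z. g z \<partial>\<nu>)"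
  shows "\<mu> = \<nu>"
proof (rule measure_eqI_generator_eq)
  note \<mu>' = prob_measuresD[OF \<mu>] and \<nu>' = prob_measuresD[OF \<nu>]
  interpret M: prob_space \<mu> by (fact \<mu>')
  interpret N: prob_space \<nu> by (fact \<nu>')
  show "sets \<mu> = sigma_sets (topspace Z) {S. openin Z S}"
    "sets \<nu> = sigma_sets (topspace Z) {S. openin Z S}"
    using \<mu>' \<nu>' by (simp_all add: sets_borel_on)
  show "Int_stable {S. openin Z S}"
    by (auto simp: Int_stable_def)
  show "{S. openin Z S} \<subseteq> Pow (topspace Z)"
    by (auto dest: openin_subset)
  have closed: "measure \<mu> C = measure \<nu> C" if C: "closedin Z C" for C
  proof -
    obtain g :: "nat \<Rightarrow> 'a \<Rightarrow> real" where g: "\<And>n. g n \<in> bounded_continuous Z"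
      and range: "\<And>n z. z \<in> topspace Z \<Longrightarrow> g n z \<in> {0..1}"
      and lim: "\<And>z. z \<in> topspace Z \<Longrightarrow> (\<lambda>n. g n z) \<longlonglongrightarrow> indicator C z"
      by (rule closed_indicator_approximation[OF Z C]) (rule that; assumption)
    have "(\<lambda>n. \<integral>z. g n z \<partial>\<nu>) \<longlonglongrightarrow> measure \<mu> C"
      using integral_tendsto_measure[OF \<mu> C g range lim] unfolding eq[OF g] .
    from LIMSEQ_unique[OF this integral_tendsto_measure[OF \<nu> C g range lim]]
    show ?thesis .
  qed
  fix S assume "S \<in> {S. openin Z S}"
  then have S: "openin Z S" by simp
  then have "S \<in> sets (borel_on Z)" "closedin Z (topspace Z - S)"
    by (auto simp: sets_borel_on)
  then have "1 - measure \<mu> S = 1 - measure \<nu> S"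
    using closed M.prob_compl[of S] N.prob_compl[of S] \<mu>' \<nu>' by simp
  then show "emeasure \<mu> S = emeasure \<nu> S"
    by (simp add: M.emeasure_eq_measure N.emeasure_eq_measure)
next
  show "emeasure \<mu> (topspace Z) \<noteq> \<infinity>"
    using prob_space.emeasure_space_1[OF prob_measuresD(1)[OF \<mu>]] prob_measuresD(3)[OF \<mu>] by simp
qed auto

lemma closedin_singleton_weak_topology:
  assumes "metrizable_space X" "\<rho> \<in> prob_measures X"
  shows "closedin (weak_topology X) {\<rho>}"
proof -
  have "(\<lambda>_. 0) \<in> bounded_continuous X"
    by (auto simp: bounded_continuous_def bounded_iff)
  then have nonempty: "bounded_continuous X \<noteq> {}"
    by blast
  have "{\<rho>} = (\<Inter>g\<in>bounded_continuous X.
      {\<mu> \<in> prob_measures X. (\<integral>x. g x \<partial>\<mu>) = (\<integral>x. g x \<partial>\<rho>)})" (is "_ = ?I")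
  proof
    show "?I \<subseteq> {\<rho>}"
    proof
      fix \<mu> assume \<mu>: "\<mu> \<in> ?I"
      then have "\<mu> \<in> prob_measures X"
        using nonempty by blast
      with \<mu> assms show "\<mu> \<in> {\<rho>}"
        by (auto intro: prob_measures_eqI_integral)
    qed
  qed (use assms in auto)
  then show ?thesis
    using closedin_INT[OF nonempty closedin_integral_eq] by simp
qed

text \<open>Integrating \<open>g\<close> against the pushforward along \<open>p\<close> is integrating \<open>g \<circ> p\<close>, which is again
  bounded and continuous; so the preimage of a subbasic weakly open set is subbasic.\<close>

lemma continuous_map_pushforward:
  assumes p: "continuous_map Z X p"
  shows "continuous_map (weak_topology Z) (weak_topology X) (\<lambda>\<mu>. distr \<mu> (borel_on X) p)"
proof -
  have p_meas: "p \<in> \<mu> \<rightarrow>\<^sub>M borel_on X" if "\<mu> \<in> prob_measures Z" for \<mu>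
    using measurable_borel_on[OF p] measurable_cong_sets[OF prob_measuresD(2)[OF that] refl] by blast
  have distr: "distr \<mu> (borel_on X) p \<in> prob_measures X" if "\<mu> \<in> prob_measures Z" for \<mu>
    using prob_space.prob_space_distr[OF prob_measuresD(1)[OF that] p_meas[OF that]]
    by (simp add: prob_measures_def)
  show ?thesis
    unfolding weak_topology_def[of X]
  proof (rule continuous_on_generated_topo)
    fix W assume "W \<in> {{\<mu> \<in> prob_measures X. (\<integral>x. g x \<partial>\<mu>) \<in> V} | g V.
        g \<in> bounded_continuous X \<and> open V}"
    then obtain g V where W: "W = {\<mu> \<in> prob_measures X. (\<integral>x. g x \<partial>\<mu>) \<in> V}"
      and g: "g \<in> bounded_continuous X" and V: "open V"
      by blast
    have "(g \<circ> p) ` topspace Z \<subseteq> g ` topspace X"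
      using continuous_map_image_subset_topspace[OF p] by auto
    then have gp: "g \<circ> p \<in> bounded_continuous Z"
      using g continuous_map_compose[OF p] bounded_subset by (auto simp: bounded_continuous_def)
    have g_meas: "g \<in> borel_measurable (borel_on X)"
      using g measurable_borel_on[of X euclideanreal g]
      by (simp add: bounded_continuous_def borel_on_euclidean)
    have "(\<integral>x. g x \<partial>distr \<mu> (borel_on X) p) = (\<integral>z. (g \<circ> p) z \<partial>\<mu>)" if "\<mu> \<in> prob_measures Z" for \<mu>
      using integral_distr[OF p_meas[OF that] g_meas] by simp
    then have "(\<lambda>\<mu>. distr \<mu> (borel_on X) p) -` W \<inter> topspace (weak_topology Z) =
        {\<mu> \<in> topspace (weak_topology Z). (\<integral>z. (g \<circ> p) z \<partial>\<mu>) \<in> V}"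
      using distr by (auto simp: W)
    then show "openin (weak_topology Z)
        ((\<lambda>\<mu>. distr \<mu> (borel_on X) p) -` W \<inter> topspace (weak_topology Z))"
      using openin_continuous_map_preimage[OF continuous_map_integral[OF gp], of V] V by simp
  next
    show "(\<lambda>\<mu>. distr \<mu> (borel_on X) p) ` topspace (weak_topology Z) \<subseteq>
        \<Union> {{\<mu> \<in> prob_measures X. (\<integral>x. g x \<partial>\<mu>) \<in> V} | g V. g \<in> bounded_continuous X \<and> open V}"
      using distr topspace_weak_topology[of X]
      unfolding weak_topology_def topology_generated_by_topspace by auto
  qed
qed

section \<open>The trajectory space\<close>

lemma metrizable_traj_space:
  assumes "metrizable_space X" "metrizable_space U" "metrizable_space Y"
  shows "metrizable_space (traj_space T X U Y)"
  using assms unfolding traj_space_def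
  by (simp add: metrizable_space_prod_topology metrizable_space_product_topology countable_finite)

lemma continuous_map_coord_X: "t \<le> T \<Longrightarrow> continuous_map (traj_space T X U Y) X (coord_X t)"
  and continuous_map_coord_U: "t < T \<Longrightarrow> continuous_map (traj_space T X U Y) U (coord_U t)"
  and continuous_map_coord_Y: "t < T \<Longrightarrow> continuous_map (traj_space T X U Y) Y (coord_Y t)"
proof -
  let ?PX = "product_topology (\<lambda>_. X) {..T}"
  let ?PU = "product_topology (\<lambda>_. U) {..<T}"
  let ?PY = "product_topology (\<lambda>_. Y) {..<T}"
  have "continuous_map (traj_space T X U Y) X ((\<lambda>x. x t) \<circ> fst)" if "t \<le> T"
    unfolding traj_space_def using that
    by (intro continuous_map_compose[of _ ?PX] continuous_map_fst continuous_map_product_projection) auto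
  moreover have "continuous_map (traj_space T X U Y) U ((\<lambda>u. u t) \<circ> (fst \<circ> snd))" if "t < T"
    unfolding traj_space_def using that
    by (intro continuous_map_compose[of _ ?PU] continuous_map_compose[of _ "prod_topology ?PU ?PY"]
        continuous_map_fst continuous_map_snd continuous_map_product_projection) auto
  moreover have "continuous_map (traj_space T X U Y) Y ((\<lambda>y. y t) \<circ> (snd \<circ> snd))" if "t < T"
    unfolding traj_space_def using that
    by (intro continuous_map_compose[of _ ?PY] continuous_map_compose[of _ "prod_topology ?PU ?PY"]
        continuous_map_snd continuous_map_product_projection) auto
  ultimately show "t \<le> T \<Longrightarrow> continuous_map (traj_space T X U Y) X (coord_X t)"
    "t < T \<Longrightarrow> continuous_map (traj_space T X U Y) U (coord_U t)"
    "t < T \<Longrightarrow> continuous_map (traj_space T X U Y) Y (coord_Y t)"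
    by (simp_all add: coord_X_def[abs_def] coord_U_def[abs_def] coord_Y_def[abs_def] comp_def)
qed

lemma closedin_admissible_paths:
  assumes "Hausdorff_space X" "Hausdorff_space Y"
    and f: "continuous_map (prod_topology X U) X f"
    and h: "continuous_map (prod_topology X U) Y h"
  shows "closedin (traj_space T X U Y) (admissible_paths T X U Y f h)"
proof -
  let ?\<Omega> = "traj_space T X U Y"
  let ?E = "\<lambda>t. {\<omega> \<in> topspace ?\<Omega>. coord_X (t + 1) \<omega> = f (coord_X t \<omega>, coord_U t \<omega>)} \<inter>
    {\<omega> \<in> topspace ?\<Omega>. coord_Y t \<omega> = h (coord_X t \<omega>, coord_U t \<omega>)}"
  have "closedin ?\<Omega> (?E t)" if t: "t < T" for t
  proof -
    have XU: "continuous_map ?\<Omega> (prod_topology X U) (\<lambda>\<omega>. (coord_X t \<omega>, coord_U t \<omega>))"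
      using t by (intro continuous_map_pairedI continuous_map_coord_X continuous_map_coord_U) auto
    have "continuous_map ?\<Omega> X (\<lambda>\<omega>. f (coord_X t \<omega>, coord_U t \<omega>))"
      "continuous_map ?\<Omega> Y (\<lambda>\<omega>. h (coord_X t \<omega>, coord_U t \<omega>))"
      using continuous_map_compose[OF XU f] continuous_map_compose[OF XU h] by (simp_all add: comp_def)
    then show ?thesis
      using t assms(1,2) by (intro closedin_Int closedin_continuous_maps_eq[where Y = X]
          closedin_continuous_maps_eq[where Y = Y] continuous_map_coord_X continuous_map_coord_Y) auto
  qed
  \<comment> \<open>The whole space is one of the intersected sets because for \<open>T = 0\<close> there are no equations.\<close>
  then have "closedin ?\<Omega> (\<Inter>(insert (topspace ?\<Omega>) (?E ` {..<T})))"
    by (intro closedin_Inter) auto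
  moreover have "admissible_paths T X U Y f h = \<Inter>(insert (topspace ?\<Omega>) (?E ` {..<T}))"
    by (auto simp: admissible_paths_def)
  ultimately show ?thesis by simp
qed

theorem theorem2p8:
  fixes T :: nat
    and X :: "'x topology" and U :: "'u topology" and Y :: "'y topology"
    and f :: "'x \<times> 'u \<Rightarrow> 'x" and h :: "'x \<times> 'u \<Rightarrow> 'y"
    and \<rho>\<^sub>0 :: "'x measure"
  assumes "Polish_space X" and "Polish_space U" and "Polish_space Y"
    and "continuous_map (prod_topology X U) X f"
    and "continuous_map (prod_topology X U) Y h"
    and "\<rho>\<^sub>0 \<in> prob_measures X"
  shows "convex_measures (behavioral_measures T X U Y f h) \<and>
    closedin (weak_topology (traj_space T X U Y)) (behavioral_measures T X U Y f h) \<and>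
    convex_measures (initial_slice T X U Y f h \<rho>\<^sub>0) \<and>
    closedin (weak_topology (traj_space T X U Y)) (initial_slice T X U Y f h \<rho>\<^sub>0)"
proof -
  let ?\<Omega> = "traj_space T X U Y" and ?M = "behavioral_measures T X U Y f h"
  have metrizable: "metrizable_space X" "metrizable_space U" "metrizable_space Y"
    using assms(1-3) by (auto simp: Polish_space_def completely_metrizable_imp_metrizable_space)
  have "closedin ?\<Omega> (admissible_paths T X U Y f h)"
    using metrizable assms(4,5) by (intro closedin_admissible_paths metrizable_imp_Hausdorff_space)
  then have closed: "closedin (weak_topology ?\<Omega>) ?M"
    unfolding behavioral_measures_def
    by (intro closedin_full_mass_on_closed metrizable_traj_space metrizable)
  have convex: "convex_measures ?M"
    unfolding behavioral_measures_def by (rule convex_measures_full_mass)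
  have "?M \<subseteq> prob_measures ?\<Omega>"
    by (auto simp: behavioral_measures_def)
  then have "convex_measures (initial_slice T X U Y f h \<rho>\<^sub>0)"
    unfolding initial_slice_def
    by (rule convex_measures_fixed_pushforward[OF convex _ coord_X_0_measurable])
  moreover have "closedin (weak_topology ?\<Omega>) (initial_slice T X U Y f h \<rho>\<^sub>0)"
    using closedin_continuous_map_preimage_gen[OF
        continuous_map_pushforward[OF continuous_map_coord_X[of 0 T X U Y]] closed
        closedin_singleton_weak_topology[OF metrizable(1) assms(6)]]
    by (simp add: initial_slice_def)
  ultimately show ?thesis
    using convex closed by blast
qed

end
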